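(* Let $N\ge1$. The classical row and column insertions of a letter into a semistandard Young tableau over the alphabet $\{1,\dots,N\}$ arise as particular cases of $\boldsymbol h$-insertions: row insertion is the $\boldsymbol h$-insertion with $\boldsymbol h=(1,1,\dots,1)$, and column insertion is the $\boldsymbol h$-insertion with $\boldsymbol h=(1,2,\dots,N)$. That is, for every semistandard tableau $\mathscr P$ over $\{1,\dots,N\}$ and every $m\in\{1,\dots,N\}$, $\mathcal I^{(1,\dots,1)}_m\mathscr P=\mathcal I^{\mathit{row}}_m\mathscr P$ and $\mathcal I^{(1,2,\dots,N)}_m\mathscr P=\mathcal I^{\mathit{col}}_m\mathscr P$.
   Context: **Tableaux and arrays.** A semistandard Young tableau over $\{1,\dots,N\}$ has entries weakly increasing along rows and strictly increasing down columns. Such tableaux are identified with interlacing arrays $\boldsymbol\lambda=(\lambda^{(1)}\prec\dots\prec\lambda^{(N)})$, $\lambda^{(k)}=(\lambda^{(k)}_1\ge\dots\ge\lambda^{(k)}_k\ge0)$ integers, $\lambda^{(k)}_{j+1}\le\lambda^{(k-1)}_j\le\lambda^{(k)}_j$: $\lambda^{(k)}$ is the shape formed by the boxes containing letters $\le k$. **Row insertion** $\mathcal I^{\mathit{row}}_m$: insert $x=m$ into the first row. Inserting $x$ into a row: if the row contains letters $>x$, the smallest such (leftmost occurrence) $y_0$ is replaced by $x$ and $y_0$ is inserted into the next row; otherwise $x$ is appended to the end of the row and the algorithm ends. **Column insertion** $\mathcal I^{\mathit{col}}_m$: insert $x=m$ into the first column. Inserting $x$ into a column: if the column contains letters $\ge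 x$, the smallest such $y_0$ is replaced by $x$ and $y_0$ is inserted into the next column; otherwise $x$ is appended to the bottom of the column and the algorithm ends. **$\boldsymbol h$-insertion** $\mathcal I^{\boldsymbol h}_m$, $\boldsymbol h=(h^{(1)},\dots,h^{(N)})$, $1\le h^{(k)}\le k$. Levels $1,\dots,m-1$ of the array do not change, and exactly one coordinate ("particle") at each level $m,\dots,N$ increases by one ("moves"), chosen as follows (all comparisons use values before the insertion). - (donation) When $\lambda^{(k)}_j$ is asked to move but is blocked, i.e. $j\ge2$ and $\lambda^{(k)}_j=\lambda^{(k-1)}_{j-1}$, then instead $\lambda^{(k)}_i$ moves, where $i<j$ is the largest index such that $\lambda^{(k)}_i$ is not blocked ($\lambda^{(k)}_1$ is never blocked). - (start) At level $m$, $\lambda^{(m)}_{h^{(m)}}$ is asked to move. - (step) Suppose $\lambda^{(k-1)}_j$ has moved, $m+1\le k\le N$. If $\lambda^{(k)}_j=\lambda^{(k-1)}_j$ or $j<h^{(k)}$, then $\lambda^{(k)}_j$ is asked to move; otherwise $\lambda^{(k)}_{j+1}$ moves. *)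

theory Defs
  imports Main
begin

(* A tableau is the list of its nonempty rows, from top to bottom; the entry in row i and
   column j (both counted from 1) is T ! (i - 1) ! (j - 1). *)

definition semistandard :: "nat \<Rightarrow> nat list list \<Rightarrow> bool" where
  "semistandard N T \<longleftrightarrow>
     (\<forall>r\<in>set T. r \<noteq> [] \<and> set r \<subseteq> {1..N} \<and> sorted r) \<and>
     (\<forall>i. Suc i < length T \<longrightarrow> length (T ! Suc i) \<le> length (T ! i)) \<and>
     (\<forall>i j. Suc i < length T \<and> j < length (T ! Suc i) \<longrightarrow> T ! i ! j < T ! Suc i ! j)"

(* An array is a function lam, where lam k j is the j-th coordinate at level k; by convention
   it vanishes unless 1 \<le> j \<le> k \<le> N. *)

definition interlacing :: "nat \<Rightarrow> (nat \<Rightarrow> nat \<Rightarrow> nat) \<Rightarrow> bool" where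
  "interlacing N lam \<longleftrightarrow>
     (\<forall>k j. \<not> (1 \<le> j \<and> j \<le> k \<and> k \<le> N) \<longrightarrow> lam k j = 0) \<and>
     (\<forall>k j. 2 \<le> k \<and> k \<le> N \<and> 1 \<le> j \<and> j < k \<longrightarrow>
        lam k (j + 1) \<le> lam (k - 1) j \<and> lam (k - 1) j \<le> lam k j)"

definition array_of :: "nat \<Rightarrow> nat list list \<Rightarrow> nat \<Rightarrow> nat \<Rightarrow> nat" where
  "array_of N T k j =
     (if 1 \<le> j \<and> j \<le> k \<and> k \<le> N \<and> j \<le> length T
      then length (filter (\<lambda>x. x \<le> k) (T ! (j - 1))) else 0)"

(* Row j contains the letter k exactly lam k j - lam (k - 1) j times. *)
definition tableau_of :: "nat \<Rightarrow> (nat \<Rightarrow> nat \<Rightarrow> nat) \<Rightarrow> nat list list" where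
  "tableau_of N lam =
     filter (\<lambda>r. r \<noteq> [])
       (map (\<lambda>j. concat (map (\<lambda>k. replicate (lam k j - lam (k - 1) j) k) [1..<N + 1]))
         [1..<N + 1])"

lemma filter_le_Suc:
  fixes r :: "nat list"
  assumes "sorted r"
  shows "filter (\<lambda>x. x \<le> Suc n) r =
    filter (\<lambda>x. x \<le> n) r @ replicate (length (filter (\<lambda>x. x = Suc n) r)) (Suc n)"
  using assms
proof (induction r)
  case (Cons a r)
  show ?case
  proof (cases "a \<le> n")
    case True
    then show ?thesis using Cons by auto
  next
    case False
    then have "filter (\<lambda>x. x \<le> n) r = []" using Cons.prems by (auto simp: filter_empty_conv)
    then show ?thesis using Cons False by auto
  qed
qed auto

lemma row_of_counts:
  fixes r :: "nat list"
  assumes "sorted r" "0 \<notin> set r"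
  shows "concat (map (\<lambda>k. replicate (length (filter (\<lambda>x. x \<le> k) r) -
    length (filter (\<lambda>x. x \<le> k - 1) r)) k) [1..<n + 1]) = filter (\<lambda>x. x \<le> n) r"
proof (induction n)
  case 0
  have "filter (\<lambda>x. x \<le> 0) r = []"
    using assms(2) by (auto simp: filter_empty_conv intro: gr0I)
  then show ?case by simp
next
  case (Suc n)
  have "[1..<Suc n + 1] = [1..<n + 1] @ [Suc n]" by simp
  then show ?case using Suc filter_le_Suc[OF assms(1), of n]
    by (simp del: upt_Suc)
qed

lemma counts_of_row:
  fixes f :: "nat \<Rightarrow> nat"
  assumes "f 0 = 0" "\<And>k. 1 \<le> k \<Longrightarrow> k \<le> N \<Longrightarrow> f (k - 1) \<le> f k"
  defines "R \<equiv> \<lambda>n. concat (map (\<lambda>k. replicate (f k - f (k - 1)) k) [1..<n + 1])"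
  assumes "n \<le> N"
  shows "(\<forall>k\<le>n. length (filter (\<lambda>x. x \<le> k) (R n)) = f k) \<and> sorted (R n) \<and> set (R n) \<subseteq> {1..n}"
  using assms(4)
proof (induction n)
  case 0
  show ?case using assms(1) by (simp add: R_def)
next
  case (Suc n)
  then have IH: "\<And>k. k \<le> n \<Longrightarrow> length (filter (\<lambda>x. x \<le> k) (R n)) = f k"
    "sorted (R n)" "set (R n) \<subseteq> {1..n}" by auto
  have R: "R (Suc n) = R n @ replicate (f (Suc n) - f n) (Suc n)" by (simp add: R_def)
  have all: "filter (\<lambda>x. x \<le> Suc n) (R n) = filter (\<lambda>x. x \<le> n) (R n)"
    by (rule filter_cong) (use IH(3) in auto)
  have m: "f n \<le> f (Suc n)" using assms(2)[of "Suc n"] Suc.prems by simp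
  have "length (filter (\<lambda>x. x \<le> k) (R (Suc n))) = f k" if "k \<le> Suc n" for k
    using that m all IH(1)[of n] IH(1)[of k] by (cases "k = Suc n") (auto simp: R)
  moreover have "sorted (R (Suc n))" using IH(2,3) by (auto simp: R sorted_append)
  moreover have "set (R (Suc n)) \<subseteq> {1..Suc n}" using IH(3) by (auto simp: R)
  ultimately show ?case by blast
qed

lemma nth_le_iff_count:
  fixes r :: "nat list"
  assumes "sorted r" "c < length r"
  shows "r ! c \<le> k \<longleftrightarrow> c < length (filter (\<lambda>x. x \<le> k) r)"
  using assms
proof (induction r arbitrary: c)
  case (Cons a r)
  show ?case
  proof (cases "a \<le> k")
    case True
    then show ?thesis using Cons by (cases c) auto
  next
    case False
    then have "filter (\<lambda>x. x \<le> k) (a # r) = []" "k < (a # r) ! c"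
      using Cons.prems by (auto simp: filter_empty_conv nth_Cons split: nat.split)
         (meson le_trans less_le_trans not_le nth_mem)+
    then show ?thesis by simp
  qed
qed auto

lemma semistandard_entry_ge:
  assumes "semistandard N T" "i < length T" "x \<in> set (T ! i)"
  shows "i + 1 \<le> x"
  using assms(2,3)
proof (induction i arbitrary: x)
  case 0
  then have "set (T ! 0) \<subseteq> {1..N}" using assms(1) unfolding semistandard_def by simp
  then show ?case using 0 by auto
next
  case (Suc i)
  then obtain j where j: "j < length (T ! Suc i)" "x = T ! Suc i ! j" by (auto simp: in_set_conv_nth)
  then have "T ! i ! j < x" "j < length (T ! i)"
    using assms(1) Suc.prems unfolding semistandard_def by (auto intro: less_le_trans)
  moreover have "i + 1 \<le> T ! i ! j" using Suc calculation(2) by (simp del: nth_mem add: nth_mem)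
  ultimately show ?case by simp
qed

lemma tableau_of_array_of:
  assumes T: "semistandard N T"
  shows "tableau_of N (array_of N T) = T"
proof -
  have len: "length T \<le> N"
  proof (rule ccontr)
    assume "\<not> ?thesis"
    then have N: "N < length T" by simp
    then have "T ! N \<noteq> []" "set (T ! N) \<subseteq> {1..N}" using T unfolding semistandard_def by auto
    then obtain x where x: "x \<in> set (T ! N)" "x \<le> N" by (cases "T ! N") auto
    then show False using semistandard_entry_ge[OF T N x(1)] by simp
  qed
  note [simp del] = upt_Suc
  define R where "R j = concat (map (\<lambda>k. replicate (array_of N T k j - array_of N T (k - 1) j) k)
    [1..<N + 1])" for j
  have row: "R j = T ! (j - 1)" if "1 \<le> j" "j \<le> length T" for j
  proof -
    let ?r = "T ! (j - 1)"
    have r: "sorted ?r" "set ?r \<subseteq> {1..N}" using T that unfolding semistandard_def by auto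
    have ge: "j \<le> x" if "x \<in> set ?r" for x
      using semistandard_entry_ge[OF T _ that] \<open>1 \<le> j\<close> \<open>j \<le> length T\<close> by simp
    have z: "array_of N T k j = length (filter (\<lambda>x. x \<le> k) ?r)" if "k \<le> N" for k
    proof (cases "j \<le> k")
      case False
      then have "filter (\<lambda>x. x \<le> k) ?r = []"
        using ge by (force simp: filter_empty_conv)
      then show ?thesis using False unfolding array_of_def by simp
    qed (use that \<open>1 \<le> j\<close> \<open>j \<le> length T\<close> in \<open>simp add: array_of_def\<close>)
    have "R j = concat (map (\<lambda>k. replicate (length (filter (\<lambda>x. x \<le> k) ?r) -
      length (filter (\<lambda>x. x \<le> k - 1) ?r)) k) [1..<N + 1])"
      unfolding R_def by (intro arg_cong[of _ _ concat] map_cong refl) (auto simp: z)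
    also have "\<dots> = filter (\<lambda>x. x \<le> N) ?r" by (rule row_of_counts) (use r in auto)
    also have "\<dots> = ?r" using r by (auto simp: filter_id_conv)
    finally show ?thesis .
  qed
  have emp: "R j = []" if "length T < j" for j
    using that by (simp add: array_of_def R_def)
  have "[1..<N + 1] = [1..<length T + 1] @ [length T + 1..<N + 1]"
    using len upt_add_eq_append[of 1 "length T + 1" "N - length T"] by simp
  then have "map R [1..<N + 1] = map R [1..<length T + 1] @ map R [length T + 1..<N + 1]"
    by simp
  also have "map R [1..<length T + 1] = T"
    by (rule nth_equalityI) (simp_all add: row)
  finally have "tableau_of N (array_of N T) =
      filter (\<lambda>r. r \<noteq> []) T @ filter (\<lambda>r. r \<noteq> []) (map R [length T + 1..<N + 1])"
    unfolding tableau_of_def R_def[symmetric] by simp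
  also have "filter (\<lambda>r. r \<noteq> []) (map R [length T + 1..<N + 1]) = []"
    by (simp add: filter_empty_conv emp)
  also have "filter (\<lambda>r. r \<noteq> []) T = T"
    using T by (auto simp: filter_id_conv semistandard_def)
  finally show ?thesis by simp
qed

lemma interlacing_array_of:
  assumes T: "semistandard N T"
  shows "interlacing N (array_of N T)"
proof -
  have up: "length (filter (\<lambda>x. x \<le> k - 1) r) \<le> length (filter (\<lambda>x. x \<le> k) r)" for k :: nat and r
    by (induction r) auto
  have down: "length (filter (\<lambda>x. x \<le> k) (T ! j)) \<le> length (filter (\<lambda>x. x \<le> k - 1) (T ! (j - 1)))"
    if j: "0 < j" "j < length T" for j k
  proof -
    obtain i where i: "j = Suc i" using j by (cases j) auto
    show ?thesis unfolding length_filter_conv_card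
    proof (intro card_mono subsetI)
      fix c assume "c \<in> {c. c < length (T ! j) \<and> T ! j ! c \<le> k}"
      moreover then have "T ! i ! c < T ! j ! c" "c < length (T ! i)"
        using T j unfolding i semistandard_def by (auto intro: less_le_trans)
      ultimately show "c \<in> {c. c < length (T ! (j - 1)) \<and> T ! (j - 1) ! c \<le> k - 1}"
        using i by auto
    qed simp
  qed
  show ?thesis unfolding interlacing_def array_of_def using up down by auto
qed

lemma tableau_of_interlacing:
  assumes lam: "interlacing N lam"
  shows "semistandard N (tableau_of N lam)" and "array_of N (tableau_of N lam) = lam"
proof -
  let ?R = "\<lambda>j. concat (map (\<lambda>k. replicate (lam k j - lam (k - 1) j) k) [1..<N + 1])"
  have zero: "lam k j = 0" if "\<not> (1 \<le> j \<and> j \<le> k \<and> k \<le> N)" for k j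
    using lam that unfolding interlacing_def by blast
  have up: "lam (k - 1) j \<le> lam k j" if "1 \<le> k" "k \<le> N" for k j
  proof (cases "1 \<le> j \<and> j < k")
    case True
    then have "2 \<le> k" by simp
    then show ?thesis using lam that True unfolding interlacing_def by blast
  qed (use zero[of j "k - 1"] that in auto)
  have down: "lam k (j + 1) \<le> lam (k - 1) j" if "1 \<le> j" for k j
  proof (cases "j < k \<and> k \<le> N")
    case True
    then have "2 \<le> k" using that by simp
    then show ?thesis using lam that True unfolding interlacing_def by blast
  qed (use zero[of "j + 1" k] that in auto)
  have cnt: "length (filter (\<lambda>x. x \<le> k) (?R j)) = lam k j" if "k \<le> N" for k j
    using counts_of_row[of "\<lambda>k. lam k j" N N] up zero[of j 0] that by auto
  have srt: "sorted (?R j)" and sub: "set (?R j) \<subseteq> {1..N}" for j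
    using counts_of_row[of "\<lambda>k. lam k j" N N] up zero[of j 0] by auto
  have len: "length (?R j) = lam N j" for j
  proof -
    have "filter (\<lambda>x. x \<le> N) (?R j) = ?R j" using sub[of j] by (auto simp: filter_id_conv simp del: upt_Suc)
    then show ?thesis using cnt[of N j] by simp
  qed
  have dec1: "lam N (j + 1) \<le> lam N j" if "1 \<le> j" for j
    using down[OF that, of N] up[of N j] zero[of "j + 1" N] by (cases "N = 0") auto
  have dec: "lam N j \<le> lam N i" if "1 \<le> i" "i \<le> j" for i j
    using that(2) by (induction j rule: dec_induct) (use that(1) dec1 in \<open>auto intro: le_trans\<close>)
  have "\<exists>p\<le>N. \<forall>j\<ge>1. lam N j \<noteq> 0 \<longleftrightarrow> j \<le> p"
  proof -
    let ?S = "{j. 1 \<le> j \<and> lam N j \<noteq> 0}"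
    have S: "?S \<subseteq> {1..N}" using zero[of _ N] by force
    show ?thesis
    proof (cases "?S = {}")
      case False
      let ?p = "Max ?S"
      have f: "finite ?S" using S finite_subset by blast
      have p: "?p \<in> ?S" using Max_in[OF f False] .
      have "lam N j \<noteq> 0 \<longleftrightarrow> j \<le> ?p" if "1 \<le> j" for j
        using dec[of j ?p] p that Max_ge[OF f, of j] by auto
      then show ?thesis using p S by (intro exI[of _ ?p]) auto
    qed (auto intro!: exI[of _ 0])
  qed
  then obtain p where p: "p \<le> N" "\<And>j. 1 \<le> j \<Longrightarrow> lam N j \<noteq> 0 \<longleftrightarrow> j \<le> p" by blast
  define R where "R j = ?R j" for j
  note [simp del] = upt_Suc
  note cnt = cnt[folded R_def] and srt = srt[folded R_def]
    and sub = sub[folded R_def] and len = len[folded R_def]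
  have ne: "R j \<noteq> [] \<longleftrightarrow> j \<le> p" if "1 \<le> j" for j
    unfolding length_0_conv[symmetric] len using p(2)[OF that] .
  let ?T = "map R [1..<p + 1]"
  have "[1..<N + 1] = [1..<p + 1] @ [p + 1..<N + 1]"
    using p(1) upt_add_eq_append[of 1 "p + 1" "N - p"] by simp
  then have "map R [1..<N + 1] = ?T @ map R [p + 1..<N + 1]"
    by simp
  moreover have "filter (\<lambda>r. r \<noteq> []) ?T = ?T"
    unfolding filter_id_conv using ne by auto
  moreover have "filter (\<lambda>r. r \<noteq> []) (map R [p + 1..<N + 1]) = []"
    unfolding filter_empty_conv using ne by fastforce
  ultimately have T: "tableau_of N lam = ?T"
    unfolding tableau_of_def R_def[symmetric] by simp
  have nth: "?T ! i = R (i + 1)" if "i < p" for i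
    using that by simp
  have lT: "length ?T = p" by simp
  have col: "R (i + 1) ! c < R (i + 2) ! c" if "c < length (R (i + 2))" for i c
  proof -
    let ?x = "R (i + 2) ! c"
    have x: "1 \<le> ?x" "?x \<le> N" using sub[of "i + 2"] nth_mem[OF that] by auto
    have "c < lam ?x (i + 2)"
      using nth_le_iff_count[OF srt that, of ?x] cnt[OF x(2), of "i + 2"] by simp
    also have "\<dots> \<le> lam (?x - 1) (i + 1)" using down[of "i + 1" ?x] by simp
    finally have c: "c < lam (?x - 1) (i + 1)" .
    have c': "c < length (R (i + 1))"
      using that dec1[of "i + 1"] unfolding len by simp
    have "R (i + 1) ! c \<le> ?x - 1"
      using nth_le_iff_count[OF srt c', of "?x - 1"] cnt[of "?x - 1" "i + 1"] c x by simp
    then show ?thesis using x by simp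
  qed
  show "semistandard N (tableau_of N lam)"
    unfolding T semistandard_def lT
  proof (intro conjI allI ballI impI)
    fix r assume "r \<in> set ?T"
    then obtain j where j: "r = R j" "1 \<le> j" "j \<le> p" by auto
    show "r \<noteq> []" "set r \<subseteq> {1..N}" "sorted r"
      unfolding j(1) using ne[OF j(2)] j(3) sub srt by blast+
  next
    fix i assume i: "Suc i < p"
    show "length (?T ! Suc i) \<le> length (?T ! i)"
      unfolding nth[OF i] nth[OF Suc_lessD[OF i]] len using dec1[of "i + 1"] by simp
  next
    fix i j assume i: "Suc i < p \<and> j < length (?T ! Suc i)"
    then have i1: "Suc i < p" by simp
    have "j < length (R (i + 2))" using i unfolding nth[OF i1] by simp
    then show "?T ! i ! j < ?T ! Suc i ! j"
      unfolding nth[OF i1] nth[OF Suc_lessD[OF i1]] using col[of j i] by simp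
  qed
  show "array_of N (tableau_of N lam) = lam"
  proof (intro ext)
    fix k j
    show "array_of N (tableau_of N lam) k j = lam k j"
    proof (cases "1 \<le> j \<and> j \<le> k \<and> k \<le> N")
      case True
      show ?thesis
      proof (cases "j \<le> p")
        case jp: True
        then have "j - 1 < p" "j - 1 + 1 = j" using True by auto
        then have "?T ! (j - 1) = R j" using nth[of "j - 1"] by (simp only:)
        then show ?thesis unfolding array_of_def T lT using True jp cnt[of k j] by (simp only:) simp
      next
        case False
        then have "R j = []" using ne[of j] True by blast
        then have "lam k j = 0" using cnt[of k j] True by simp
        then show ?thesis unfolding array_of_def T lT using False by simp
      qed
    next
      case False
      then show ?thesis using zero[OF False] by (auto simp: array_of_def)
    qed
  qed
qed

lemma bij_betw_array_of:
  "bij_betw (array_of N) {T. semistandard N T} {lam. interlacing N lam}"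
  by (rule bij_betw_byWitness[where f' = "tableau_of N"])
    (auto simp: tableau_of_array_of interlacing_array_of tableau_of_interlacing)

definition replace_leftmost :: "'a \<Rightarrow> 'a \<Rightarrow> 'a list \<Rightarrow> 'a list" where
  "replace_leftmost y x r = r[length (takeWhile (\<lambda>z. z \<noteq> y) r) := x]"

(* Insertion of a letter into a list of lines (rows or columns); a letter y of a line can be
   bumped by x when R x y holds. *)
fun bump_insert :: "(nat \<Rightarrow> nat \<Rightarrow> bool) \<Rightarrow> nat \<Rightarrow> nat list list \<Rightarrow> nat list list" where
  "bump_insert R x [] = [[x]]"
| "bump_insert R x (l # ls) =
     (if \<exists>y\<in>set l. R x y
      then let y0 = Min {y \<in> set l. R x y}
           in replace_leftmost y0 x l # bump_insert R y0 ls
      else (l @ [x]) # ls)"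

definition row_insertion :: "nat \<Rightarrow> nat list list \<Rightarrow> nat list list" where
  "row_insertion m T = bump_insert (<) m T"

(* transpose turns the list of rows into the list of columns and back. *)
definition col_insertion :: "nat \<Rightarrow> nat list list \<Rightarrow> nat list list" where
  "col_insertion m T = transpose (bump_insert (\<le>) m (transpose T))"

definition h_vector :: "nat \<Rightarrow> (nat \<Rightarrow> nat) \<Rightarrow> bool" where
  "h_vector N h \<longleftrightarrow> (\<forall>k\<in>{1..N}. 1 \<le> h k \<and> h k \<le> k)"

definition blocked :: "(nat \<Rightarrow> nat \<Rightarrow> nat) \<Rightarrow> nat \<Rightarrow> nat \<Rightarrow> bool" where
  "blocked lam k j \<longleftrightarrow> 2 \<le> j \<and> lam k j = lam (k - 1) (j - 1)"

(* The index of the coordinate at level k that moves when the j-th one is asked to move. *)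
definition donate :: "(nat \<Rightarrow> nat \<Rightarrow> nat) \<Rightarrow> nat \<Rightarrow> nat \<Rightarrow> nat" where
  "donate lam k j =
     (if blocked lam k j then Max {i \<in> {1..<j}. \<not> blocked lam k i} else j)"

(* moved lam h m d is the index of the coordinate that moves at level m + d. In the last branch
   lam k (j + 1) moves without donation: it can only be blocked by the value of lam (k - 1) j
   before that coordinate moved. *)
fun moved :: "(nat \<Rightarrow> nat \<Rightarrow> nat) \<Rightarrow> (nat \<Rightarrow> nat) \<Rightarrow> nat \<Rightarrow> nat \<Rightarrow> nat" where
  "moved lam h m 0 = donate lam m (h m)"
| "moved lam h m (Suc d) =
     (let k = m + Suc d; j = moved lam h m d
      in if lam k j = lam (k - 1) j \<or> j < h k then donate lam k j else j + 1)"

definition h_insertion_array ::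
  "nat \<Rightarrow> (nat \<Rightarrow> nat) \<Rightarrow> nat \<Rightarrow> (nat \<Rightarrow> nat \<Rightarrow> nat) \<Rightarrow> nat \<Rightarrow> nat \<Rightarrow> nat" where
  "h_insertion_array N h m lam k j =
     (if m \<le> k \<and> k \<le> N \<and> j = moved lam h m (k - m) then lam k j + 1 else lam k j)"

definition h_insertion ::
  "nat \<Rightarrow> (nat \<Rightarrow> nat) \<Rightarrow> nat \<Rightarrow> nat list list \<Rightarrow> nat list list" where
  "h_insertion N h m T = tableau_of N (h_insertion_array N h m (array_of N T))"

end

theory Submission
  imports Defs
begin

text \<open>A bumping process that puts \<open>x\<^sub>j\<close> into the \<open>j\<close>-th line and takes \<open>x\<^bsub>j+1\<^esub>\<close> out of it raises the
  number of letters \<open>\<le> k\<close> of exactly one line \<open>f k\<close>, the one with \<open>x\<^sub>j \<le> k < x\<^bsub>j+1\<^esub>\<close>. For rows, \<open>f k\<close>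
  is the (0-based) index of the moving particle; it passes to the next row at level \<open>k + 1\<close> iff row
  \<open>f k\<close> contains \<open>k + 1\<close>, and no particle asked to move is ever blocked. For columns,
  \<open>f (k + 1)\<close> is the first column from \<open>f k\<close> on that does not contain \<open>k + 1\<close>, and the moving
  particle is the height of the letters \<open>\<le> k\<close> in column \<open>f k\<close>; every column passed over makes the
  particles sitting there blocked, so that donation performs exactly this search.\<close>

section \<open>Counting letters in the lines of a tableau\<close>

definition count_le :: "nat \<Rightarrow> nat list \<Rightarrow> nat" where
  "count_le k l = length (filter (\<lambda>x. x \<le> k) l)"

text \<open>Padding with empty lines makes counts total in the index, so a line created by an
  insertion is an empty line that grows.\<close>

definition line :: "'a list list \<Rightarrow> nat \<Rightarrow> 'a list" where
  "line T i = (if i < length T then T ! i else [])"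

lemma line_simps [simp]:
  "line [] i = []" "line (l # ls) 0 = l" "line (l # ls) (Suc i) = line ls i"
  by (auto simp: line_def)

lemma count_le_Nil [simp]: "count_le k [] = 0"
  by (simp add: count_le_def)

lemma count_le_mono: "k \<le> k' \<Longrightarrow> count_le k l \<le> count_le k' l"
  unfolding count_le_def by (induction l) auto

lemma count_le_le_length: "count_le k l \<le> length l"
  by (simp add: count_le_def)

lemma count_le_eq_length: "set l \<subseteq> {..k} \<Longrightarrow> count_le k l = length l"
  unfolding count_le_def by (simp add: filter_id_conv subset_eq)

lemma count_le_Suc_eq: "Suc k \<notin> set l \<Longrightarrow> count_le (Suc k) l = count_le k l"
  unfolding count_le_def by (rule arg_cong[of _ _ length], rule filter_cong) (auto simp: le_Suc_eq)

lemma count_le_Suc_less: "Suc k \<in> set l \<Longrightarrow> count_le k l < count_le (Suc k) l"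
proof (induction l)
  case (Cons a l)
  then show ?case using count_le_mono[of k "Suc k" l] by (auto simp: count_le_def)
qed simp

text \<open>The letters \<open>\<le> k\<close> of a sorted line form an initial segment; this
  translates between entries and counts.\<close>

lemma less_count_le_line_iff:
  assumes "\<forall>l\<in>set T. sorted l"
  shows "c < count_le k (line T i) \<longleftrightarrow> i < length T \<and> c < length (T ! i) \<and> T ! i ! c \<le> k"
  using nth_le_iff_count[of "T ! i" c k] assms count_le_le_length[of k "T ! i"]
  by (auto simp: line_def count_le_def[symmetric])

section \<open>Bumping a letter out of one line\<close>

text \<open>Stated for \<open>R\<close> so as to cover both \<open><\<close> and
  \<open>\<le>\<close>. Letters before the leftmost \<open>y0\<close> are at most \<open>x\<close>,
  so the order survives, and trading \<open>y0\<close> for \<open>x\<close> changes the counts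
  exactly at the levels \<open>x \<le> k < y0\<close>.\<close>

lemma bump_line:
  assumes "sorted l" "\<exists>y\<in>set l. R x y"
    and R: "\<And>y. R x y \<Longrightarrow> x \<le> y" "\<And>y. \<not> R x y \<Longrightarrow> y \<le> x"
  defines "y0 \<equiv> Min {y \<in> set l. R x y}"
  shows "sorted (replace_leftmost y0 x l)"
    and "set (replace_leftmost y0 x l) \<subseteq> insert x (set l)"
    and "count_le k (replace_leftmost y0 x l) =
      count_le k l + (if x \<le> k \<and> k < y0 then 1 else 0)"
    and "y0 \<in> set l" "R x y0" "\<And>y. y \<in> set l \<Longrightarrow> R x y \<Longrightarrow> y0 \<le> y"
proof -
  have "y0 \<in> {y \<in> set l. R x y}" unfolding y0_def by (rule Min_in) (use assms(2) in auto)
  then show y0: "y0 \<in> set l" "R x y0" by auto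
  show min: "\<And>y. y \<in> set l \<Longrightarrow> R x y \<Longrightarrow> y0 \<le> y" unfolding y0_def by (rule Min_le) auto
  obtain a b where l: "l = a @ y0 # b" "y0 \<notin> set a" using split_list_first[OF y0(1)] by blast
  have tw: "takeWhile (\<lambda>z. z \<noteq> y0) l = a" using l by (auto simp: takeWhile_append)
  have r: "replace_leftmost y0 x l = a @ x # b"
    unfolding replace_leftmost_def tw by (simp add: l(1) list_update_append)
  have a: "y \<le> x" if "y \<in> set a" for y
  proof -
    have "y \<le> y0" using assms(1) that unfolding l(1) by (auto simp: sorted_append)
    moreover have "y \<noteq> y0" using that l(2) by blast
    ultimately show ?thesis using min[of y] that R(2)[of y] l(1) by auto
  qed
  have x: "x \<le> y0" using R y0 by blast
  show "sorted (replace_leftmost y0 x l)"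
    using assms(1) a x unfolding r unfolding l(1) by (auto simp: sorted_append)
  show "set (replace_leftmost y0 x l) \<subseteq> insert x (set l)" unfolding r unfolding l(1) by auto
  show "count_le k (replace_leftmost y0 x l) =
      count_le k l + (if x \<le> k \<and> k < y0 then 1 else 0)"
    using x unfolding r unfolding l(1) count_le_def by auto
qed

text \<open>The properties shared by the rows and the columns of a tableau, so that one invariant
  serves both insertions.\<close>

definition lines_in :: "nat set \<Rightarrow> nat list list \<Rightarrow> bool" where
  "lines_in A T \<longleftrightarrow> (\<forall>l\<in>set T. l \<noteq> [] \<and> sorted l \<and> set l \<subseteq> A)"

lemma lines_in_bump_insert:
  assumes "lines_in A T" "x \<in> A"
    and R: "\<And>x y. R x y \<Longrightarrow> x \<le> y" "\<And>x y. \<not> R x y \<Longrightarrow> y \<le> x"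
  shows "lines_in A (bump_insert R x T)"
  using assms(1,2)
proof (induction T arbitrary: x)
  case Nil
  then show ?case by (simp add: lines_in_def)
next
  case (Cons l ls)
  have l: "sorted l" "l \<noteq> []" "set l \<subseteq> A" and ls: "lines_in A ls"
    using Cons.prems by (auto simp: lines_in_def)
  show ?case
  proof (cases "\<exists>y\<in>set l. R x y")
    case True
    define y0 where "y0 = Min {y \<in> set l. R x y}"
    note b = bump_line[where R = R and x = x, OF l(1) True R, folded y0_def]
    have "lines_in A (bump_insert R y0 ls)" using Cons.IH[OF ls] b(4) l(3) by blast
    moreover have "replace_leftmost y0 x l \<noteq> []"
      using l(2) by (simp add: replace_leftmost_def)
    moreover have "set (replace_leftmost y0 x l) \<subseteq> A" using b(2) l(3) Cons.prems(2) by blast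
    ultimately show ?thesis using True b(1)
      by (simp add: lines_in_def y0_def[symmetric] Let_def)
  next
    case False
    then have "\<forall>y\<in>set l. y \<le> x" using R(2) by blast
    then show ?thesis using False l ls Cons.prems by (auto simp: lines_in_def sorted_append)
  qed
qed

section \<open>The path of an insertion through the levels\<close>

text \<open>The letter bumped by \<open>x\<close> is the least one above \<open>x\<close> in its
  row, so the path leaves row \<open>f k\<close> at level \<open>Suc k\<close> exactly when this row
  contains \<open>Suc k\<close>.\<close>

lemma bump_insert_less_path:
  assumes "\<forall>l\<in>set T. sorted l"
  obtains f where "f x = 0"
    and "\<And>k. x \<le> k \<Longrightarrow> f (Suc k) = (if Suc k \<in> set (line T (f k)) then Suc (f k) else f k)"
    and "\<And>k j. count_le k (line (bump_insert (<) x T) j) =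
      count_le k (line T j) + (if x \<le> k \<and> j = f k then 1 else 0)"
  using assms
proof (induction T arbitrary: x thesis)
  case Nil
  show ?case
  proof (rule Nil(1)[of "\<lambda>_. 0"])
    show "count_le k (line (bump_insert (<) x []) j) =
      count_le k (line [] j) + (if x \<le> k \<and> j = 0 then 1 else 0)" for k j
      by (cases j) (auto simp: count_le_def)
  qed auto
next
  case (Cons l ls)
  have l: "sorted l" and ls: "\<forall>l\<in>set ls. sorted l" using Cons.prems by auto
  show ?case
  proof (cases "\<exists>y\<in>set l. x < y")
    case True
    define y0 where "y0 = Min {y \<in> set l. x < y}"
    note b = bump_line[where R = "(<)", OF l True less_imp_le leI, folded y0_def]
    obtain f where f: "f y0 = 0"
      "\<And>k. y0 \<le> k \<Longrightarrow> f (Suc k) = (if Suc k \<in> set (line ls (f k)) then Suc (f k) else f k)"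
      "\<And>k j. count_le k (line (bump_insert (<) y0 ls) j) =
        count_le k (line ls j) + (if y0 \<le> k \<and> j = f k then 1 else 0)"
      using Cons.IH[of y0] ls by blast
    have ins: "bump_insert (<) x (l # ls) = replace_leftmost y0 x l # bump_insert (<) y0 ls"
      using True by (simp add: y0_def Let_def)
    show ?thesis
    \<comment> \<open>The path stays in the first row below level \<open>y0\<close>; from there on
      it is the path of \<open>y0\<close> through the remaining rows, shifted by one.\<close>
    proof (rule Cons.prems(1)[of "\<lambda>k. if k < y0 then 0 else Suc (f k)"], goal_cases)
      case 1
      then show ?case using b(5) by simp
    next
      case (2 k)
      consider "Suc k < y0" | "Suc k = y0" | "y0 \<le> k" by linarith
      then show ?case
      proof cases
        case 1
        then show ?thesis using 2 b(6)[of "Suc k"] by auto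
      next
        case 2
        then show ?thesis using b(4) f(1) by auto
      next
        case 3
        then show ?thesis using f(2) by auto
      qed
    next
      case (3 k j)
      then show ?case unfolding ins using b(3)[of k] b(5) f(3) by (cases j) auto
    qed
  next
    case False
    show ?thesis
    proof (rule Cons.prems(1)[of "\<lambda>_. 0"], goal_cases)
      case (3 k j)
      then show ?case using False by (cases j) (auto simp: count_le_def)
    qed (use False in auto)
  qed
qed

text \<open>A letter equal to \<open>x\<close> is bumped too, so at a single level the path can
  cross several columns. Hence the form of a search for the first column without the letter, instead
  of a one-step recursion.\<close>

lemma bump_insert_le_path:
  assumes "\<forall>l\<in>set T. sorted l"
  obtains f where "x \<notin> set (line T (f x))" "\<And>c. c < f x \<Longrightarrow> x \<in> set (line T c)"
    and "\<And>k. x \<le> k \<Longrightarrow> f k \<le> f (Suc k)" "\<And>k. x \<le> k \<Longrightarrow> Suc k \<notin> set (line T (f (Suc k)))"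
    and "\<And>k c. x \<le> k \<Longrightarrow> f k \<le> c \<Longrightarrow> c < f (Suc k) \<Longrightarrow> Suc k \<in> set (line T c)"
    and "\<And>k j. count_le k (line (bump_insert (\<le>) x T) j) =
      count_le k (line T j) + (if x \<le> k \<and> j = f k then 1 else 0)"
  using assms
proof (induction T arbitrary: x thesis)
  case Nil
  show ?case
  proof (rule Nil(1)[of "\<lambda>_. 0"])
    show "count_le k (line (bump_insert (\<le>) x []) j) =
      count_le k (line [] j) + (if x \<le> k \<and> j = 0 then 1 else 0)" for k j
      by (cases j) (auto simp: count_le_def)
  qed auto
next
  case (Cons l ls)
  have l: "sorted l" and ls: "\<forall>l\<in>set ls. sorted l" using Cons.prems by auto
  show ?case
  proof (cases "\<exists>y\<in>set l. x \<le> y")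
    case True
    define y0 where "y0 = Min {y \<in> set l. x \<le> y}"
    have nle: "\<not> x \<le> y \<Longrightarrow> y \<le> x" for y by simp
    note b = bump_line[where R = "(\<le>)", OF l True _ nle, folded y0_def, simplified]
    obtain f where f: "y0 \<notin> set (line ls (f y0))" "\<And>c. c < f y0 \<Longrightarrow> y0 \<in> set (line ls c)"
      "\<And>k. y0 \<le> k \<Longrightarrow> f k \<le> f (Suc k)" "\<And>k. y0 \<le> k \<Longrightarrow> Suc k \<notin> set (line ls (f (Suc k)))"
      "\<And>k c. y0 \<le> k \<Longrightarrow> f k \<le> c \<Longrightarrow> c < f (Suc k) \<Longrightarrow> Suc k \<in> set (line ls c)"
      "\<And>k j. count_le k (line (bump_insert (\<le>) y0 ls) j) =
        count_le k (line ls j) + (if y0 \<le> k \<and> j = f k then 1 else 0)"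
      using Cons.IH[of y0] ls by blast
    have ins: "bump_insert (\<le>) x (l # ls) = replace_leftmost y0 x l # bump_insert (\<le>) y0 ls"
      using True by (simp add: y0_def Let_def)
    show ?thesis
    \<comment> \<open>If \<open>x\<close> occurs in \<open>l\<close>, then \<open>y0 = x\<close> and
      the path has left this column already at level \<open>x\<close>.\<close>
    proof (rule Cons.prems(1)[of "\<lambda>k. if k < y0 then 0 else Suc (f k)"], goal_cases)
      case 1
      then show ?case using b(5) b(6)[of x] f(1) by (auto simp: not_less le_antisym)
    next
      case (2 c)
      then show ?case using b(4,5) f(2) by (cases c) (auto simp: not_less le_antisym split: if_splits)
    next
      case (3 k)
      then show ?case using f(3) by auto
    next
      case (4 k)
      then show ?case using b(6)[of "Suc k"] f(1) f(4)[of k]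
        by (cases "Suc k = y0") (auto simp: not_less less_Suc_eq_le)
    next
      case (5 k c)
      consider "Suc k < y0" | "Suc k = y0" | "y0 \<le> k" by linarith
      then show ?case
      proof cases
        case 2
        then show ?thesis using 5 b(4) f(2) by (cases c) auto
      next
        case 3
        then show ?thesis using 5 f(5)[of k] by (cases c) auto
      qed (use 5 in auto)
    next
      case (6 k j)
      then show ?case unfolding ins using b(3)[of k] b(5) f(6) by (cases j) auto
    qed
  next
    case False
    show ?thesis
    proof (rule Cons.prems(1)[of "\<lambda>_. 0"], goal_cases)
      case (6 k j)
      then show ?case using False by (cases j) (auto simp: count_le_def)
    qed (use False in auto)
  qed
qed

section \<open>Semistandardness and arrays in terms of counts\<close>

lemma lines_in_sorted: "lines_in A T \<Longrightarrow> \<forall>l\<in>set T. sorted l"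
  by (simp add: lines_in_def)

lemma set_line_subset: "lines_in A T \<Longrightarrow> set (line T i) \<subseteq> A"
  by (auto simp: lines_in_def line_def)

lemma semistandard_lines_in: "semistandard N T \<Longrightarrow> lines_in {1..N} T"
  by (simp add: semistandard_def lines_in_def)

text \<open>A letter \<open>\<le> Suc k\<close> stands below a smaller one, hence below a letter
  \<open>\<le> k\<close>.\<close>

lemma semistandard_count_le:
  assumes T: "semistandard N T"
  shows "count_le (Suc k) (line T (Suc i)) \<le> count_le k (line T i)"
proof (rule ccontr)
  assume "\<not> ?thesis"
  then have "count_le k (line T i) < count_le (Suc k) (line T (Suc i))" (is "?c < _") by simp
  note sorted = lines_in_sorted[OF semistandard_lines_in[OF T]]
  have "Suc i < length T" "?c < length (T ! Suc i)" "T ! Suc i ! ?c \<le> Suc k"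
    using less_count_le_line_iff[OF sorted] \<open>?c < _\<close> by auto
  moreover then have "T ! i ! ?c < T ! Suc i ! ?c" "?c < length (T ! i)"
    using T unfolding semistandard_def by (auto intro: less_le_trans)
  ultimately have "?c < count_le k (line T i)" by (subst less_count_le_line_iff[OF sorted]) auto
  then show False by simp
qed

text \<open>Level \<open>N\<close> compares the row lengths; the level of an entry forces the entry
  above it to be smaller.\<close>

lemma semistandardI:
  assumes "lines_in {1..N} T"
    and le: "\<And>k i. count_le (Suc k) (line T (Suc i)) \<le> count_le k (line T i)"
  shows "semistandard N T"
proof -
  note sorted = lines_in_sorted[OF assms(1)]
  have sub: "set (line T i) \<subseteq> {1..N}" for i using set_line_subset[OF assms(1)] .
  have "length (T ! Suc i) \<le> length (T ! i)" if "Suc i < length T" for i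
  proof -
    have "length (T ! Suc i) = count_le (Suc N) (line T (Suc i))"
      using that sub[of "Suc i"] by (subst count_le_eq_length) (auto simp: line_def)
    also have "\<dots> \<le> length (T ! i)"
      using le[of N i] that count_le_le_length[of N "T ! i"] by (simp add: line_def)
    finally show ?thesis .
  qed
  moreover have "T ! i ! j < T ! Suc i ! j" if "Suc i < length T" "j < length (T ! Suc i)" for i j
  proof -
    have "T ! Suc i ! j \<in> set (line T (Suc i))" using that by (simp add: line_def)
    then have "T ! Suc i ! j \<in> {1..N}" using sub by blast
    then obtain v where v: "T ! Suc i ! j = Suc v" by (cases "T ! Suc i ! j") auto
    have "j < count_le (Suc v) (line T (Suc i))"
      unfolding less_count_le_line_iff[OF sorted] using that v by simp
    also note le
    finally show ?thesis unfolding less_count_le_line_iff[OF sorted] using v by simp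
  qed
  ultimately show ?thesis using assms(1) unfolding semistandard_def lines_in_def by blast
qed

text \<open>Entries of row \<open>i\<close>, counted from 0, exceed \<open>i\<close>; hence the
  counts vanish where \<open>array_of\<close> is set to 0.\<close>

lemma array_of_eq_count_le:
  assumes T: "semistandard N T" and "k \<le> N"
  shows "array_of N T k (Suc i) = count_le k (line T i)"
proof (cases "i < k")
  case False
  have "filter (\<lambda>x. x \<le> k) (line T i) = []"
    using semistandard_entry_ge[OF T] False by (force simp: filter_empty_conv line_def)
  then show ?thesis using False by (simp add: array_of_def count_le_def)
next
  case True
  then show ?thesis using assms(2) by (simp add: array_of_def count_le_def line_def)
qed

lemma array_of_eq_0 [simp]: "array_of N T k 0 = 0" "N < k \<Longrightarrow> array_of N T k j = 0"
  by (simp_all add: array_of_def)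

lemma semistandard_count_le_pos:
  assumes "semistandard N T" "0 < count_le k (line T i)"
  shows "i < k"
proof -
  have "i < length T" "length (T ! i) > 0" "T ! i ! 0 \<le> k"
    using less_count_le_line_iff[OF lines_in_sorted[OF semistandard_lines_in[OF assms(1)]], of 0] assms(2)
    by auto
  then show ?thesis using semistandard_entry_ge[OF assms(1), of i "T ! i ! 0"] by auto
qed

section \<open>Recognizing an h-insertion\<close>

text \<open>An array determines its tableau, so it suffices that the same coordinates grow;
  \<open>g k\<close> is the row, counted from 0, that grows at level \<open>k\<close>.\<close>

lemma h_insertion_eqI:
  assumes T: "semistandard N T" and T': "semistandard N T'"
    and count: "\<And>k i. k \<le> N \<Longrightarrow> count_le k (line T' i) =
      count_le k (line T i) + (if m \<le> k \<and> i = g k then 1 else 0)"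
    and g: "\<And>d. m + d \<le> N \<Longrightarrow> moved (array_of N T) h m d = Suc (g (m + d))"
  shows "h_insertion N h m T = T'"
proof -
  have "h_insertion_array N h m (array_of N T) k j = array_of N T' k j" for k j
  proof (cases "k \<le> N")
    case True
    have mv: "moved (array_of N T) h m (k - m) = Suc (g k)" if "m \<le> k"
      using g[of "k - m"] that True by simp
    show ?thesis
      using True mv count[OF True] array_of_eq_count_le[OF T True] array_of_eq_count_le[OF T' True]
      by (cases j) (auto simp: h_insertion_array_def)
  qed (simp add: h_insertion_array_def)
  then have "h_insertion_array N h m (array_of N T) = array_of N T'" by blast
  then show ?thesis unfolding h_insertion_def using tableau_of_array_of[OF T'] by simp
qed

lemma donate_eqI:
  assumes "1 \<le> i'" "i' \<le> i" "\<not> blocked lam k i'" "\<And>r. i' < r \<Longrightarrow> r \<le> i \<Longrightarrow> blocked lam k r"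
  shows "donate lam k i = i'"
proof (cases "i' = i")
  case False
  have "Max {r \<in> {1..<i}. \<not> blocked lam k r} = i'"
  proof (rule Max_eqI)
    fix r assume r: "r \<in> {r \<in> {1..<i}. \<not> blocked lam k r}"
    then show "r \<le> i'" using assms(4)[of r] by force
  qed (use assms False in auto)
  then show ?thesis using assms False by (simp add: donate_def)
qed (use assms in \<open>simp add: donate_def\<close>)

section \<open>Row insertion\<close>

lemma h_insertion_eq_row_insertion:
  assumes T: "semistandard N T" and m: "m \<in> {1..N}"
  shows "h_insertion N (\<lambda>k. 1) m T = row_insertion m T"
proof -
  let ?L = "\<lambda>k i. count_le k (line T i)" and ?T' = "bump_insert (<) m T"
  note lin = semistandard_lines_in[OF T] and L = semistandard_count_le[OF T]
  obtain f where f: "f m = 0"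
    "\<And>k. m \<le> k \<Longrightarrow> f (Suc k) = (if Suc k \<in> set (line T (f k)) then Suc (f k) else f k)"
    "\<And>k j. count_le k (line ?T' j) = ?L k j + (if m \<le> k \<and> j = f k then 1 else 0)"
    using bump_insert_less_path[OF lines_in_sorted[OF lin]] by blast
  have mono: "?L k i \<le> ?L (Suc k) i" for k i by (rule count_le_mono) simp
  \<comment> \<open>Room for the new box: this gives both the interlacing of \<open>?T'\<close> and
    the freedom of the particle asked to move.\<close>
  have corner: "f k = Suc j \<Longrightarrow> ?L k (Suc j) < ?L k j" if "m \<le> k" for k j
    using that
  proof (induction k arbitrary: j rule: dec_induct)
    case base
    then show ?case using f(1) by simp
  next
    case (step k)
    show ?case
    proof (cases "Suc k \<in> set (line T (f k))")
      case True
      \<comment> \<open>The path comes from row \<open>j\<close>, which contains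
        \<open>Suc k\<close> and so is longer at level \<open>Suc k\<close> than at level
        \<open>k\<close>.\<close>
      then have "f k = j" using f(2) step by simp
      then show ?thesis using L[of k j] count_le_Suc_less[OF True] by simp
    next
      case False
      then have "f k = Suc j" using f(2) step by simp
      then show ?thesis using step.IH[of j] count_le_Suc_eq[OF False] mono[of k j] by simp
    qed
  qed
  have T': "semistandard N ?T'"
  proof (rule semistandardI)
    show "lines_in {1..N} ?T'" by (rule lines_in_bump_insert[OF lin m]) auto
    fix k i
    show "count_le (Suc k) (line ?T' (Suc i)) \<le> count_le k (line ?T' i)"
    \<comment> \<open>Only a gain of row \<open>Suc i\<close> at level \<open>Suc k\<close> can
      break the inequality. Then either row \<open>i\<close> gains at level \<open>k\<close>, or
      \<open>corner\<close> provides the slack.\<close>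
    proof (cases "m \<le> Suc k \<and> Suc i = f (Suc k)")
      case True
      then have mk: "m \<le> k" using f(1) by (cases "m = Suc k") auto
      show ?thesis
      proof (cases "Suc k \<in> set (line T (f k))")
        case s: True
        then show ?thesis using f(2)[OF mk] True mk L[of k i] by (simp add: f(3))
      next
        case s: False
        have fk: "f k = Suc i" "f (Suc k) = Suc i" using f(2)[OF mk] True s by simp_all
        then show ?thesis using corner[OF mk fk(1)] count_le_Suc_eq[OF s] by (simp add: f(3))
      qed
    next
      case False
      then show ?thesis using L[of k i] by (auto simp: f(3))
    qed
  qed
  show ?thesis unfolding row_insertion_def
  proof (rule h_insertion_eqI[OF T T'])
    fix k i
    show "count_le k (line ?T' i) = ?L k i + (if m \<le> k \<and> i = f k then 1 else 0)" by (rule f(3))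
  next
    fix d
    show "m + d \<le> N \<Longrightarrow> moved (array_of N T) (\<lambda>k. 1) m d = Suc (f (m + d))"
    proof (induction d)
      case 0
      then show ?case using f(1) by (simp add: donate_def blocked_def)
    next
      case (Suc d)
      let ?k = "m + d"
      have A: "array_of N T ?k (Suc i) = ?L ?k i" "array_of N T (Suc ?k) (Suc i) = ?L (Suc ?k) i" for i
        using array_of_eq_count_le[OF T] Suc.prems by auto
      have IH: "moved (array_of N T) (\<lambda>k. 1) m d = Suc (f ?k)" using Suc by simp
      show ?case
      \<comment> \<open>With \<open>h k = 1\<close> the condition \<open>j < h k\<close> always
        fails, so the step only tests whether row \<open>f ?k\<close> contains
        \<open>Suc ?k\<close>.\<close>
      proof (cases "Suc ?k \<in> set (line T (f ?k))")
        case True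
        then show ?thesis using IH f(2)[of ?k] A count_le_Suc_less[OF True] by (simp add: Let_def)
      next
        case False
        have "\<not> blocked (array_of N T) (Suc ?k) (Suc (f ?k))"
          using corner[of ?k] A count_le_Suc_eq[OF False] by (cases "f ?k") (auto simp: blocked_def)
        then show ?thesis
          using IH f(2)[of ?k] A count_le_Suc_eq[OF False] False by (simp add: Let_def donate_def)
      qed
    qed
  qed
qed

section \<open>Transposition of tableaux\<close>

lemma less_length_transpose_iff: "c < length (transpose T) \<longleftrightarrow> (\<exists>l\<in>set T. c < length l)"
proof -
  have "c < foldr (\<lambda>l. max (length l)) T 0 \<longleftrightarrow> (\<exists>l\<in>set T. c < length l)"
    by (induction T) auto
  then show ?thesis by (simp add: length_transpose)
qed

text \<open>Row lengths decrease weakly, so the rows that reach column \<open>c\<close> come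
  first.\<close>

lemma less_length_filter_iff:
  assumes "sorted (rev (map length T))"
  shows "i < length (filter (\<lambda>l. c < length l) T) \<longleftrightarrow> i < length T \<and> c < length (T ! i)"
  using assms
proof (induction T arbitrary: i)
  case (Cons a T)
  have a: "length l \<le> length a" if "l \<in> set T" for l
    using Cons.prems that by (auto simp: sorted_append)
  have IH: "i < length (filter (\<lambda>l. c < length l) T) \<longleftrightarrow> i < length T \<and> c < length (T ! i)" for i
    using Cons by (simp add: sorted_append)
  show ?case
  proof (cases "c < length a")
    case True
    then show ?thesis using IH by (cases i) auto
  next
    case False
    then have "\<not> c < length l" if "l \<in> set (a # T)" for l using a[of l] that by auto
    then show ?thesis using nth_mem[of i "a # T"] by (auto simp del: nth_mem)
  qed
qed simp

lemma transpose_cell_iff: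
  assumes "sorted (rev (map length T))"
  shows "c < length (transpose T) \<and> i < length (transpose T ! c) \<longleftrightarrow>
    i < length T \<and> c < length (T ! i)"
proof (cases "c < length (transpose T)")
  case True
  then show ?thesis using less_length_filter_iff[OF assms, of i c] by (simp add: nth_transpose)
next
  case False
  then have "\<not> (i < length T \<and> c < length (T ! i))"
    unfolding less_length_transpose_iff using nth_mem by blast
  then show ?thesis using False by blast
qed

text \<open>For rows and columns of a tableau, both sides of the equivalence say that the cell in row
  \<open>i\<close> and column \<open>c\<close> carries a letter \<open>\<le> k\<close>.\<close>
lemma transpose_lines:
  assumes lin: "lines_in A T" and fin: "finite A"
    and le: "\<And>k i. count_le k (line T (Suc i)) \<le> count_le k (line T i)"
  shows "lines_in A (transpose T)"
    and "c < count_le k (line T i) \<longleftrightarrow> i < count_le k (line (transpose T) c)"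
proof -
  note sorted = lines_in_sorted[OF lin]
  \<comment> \<open>At a level \<open>K\<close> above all letters, counts are lengths, and
    \<open>le\<close> compares row lengths.\<close>
  obtain K where K: "A \<subseteq> {..K}" using fin by (meson finite_nat_set_iff_bounded_le atMost_iff subsetI)
  have length: "length (line T i) = count_le K (line T i)" for i
    using set_line_subset[OF lin, of i] K by (subst count_le_eq_length) auto
  have "length (line T (Suc i)) \<le> length (line T i)" for i using le[of K i] by (simp add: length)
  then have "length (line T j) \<le> length (line T i)" if "i \<le> j" for i j
    using that lift_Suc_antimono_le[of "\<lambda>i. length (line T i)"] by blast
  then have len: "length (T ! j) \<le> length (T ! i)" if "i \<le> j" "j < length T" for i j
    using that by (metis line_def order.strict_trans1)
  then have srt: "sorted (rev (map length T))"
    by (auto simp: sorted_iff_nth_mono rev_nth)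
  note cell = transpose_cell_iff[OF srt]
  have nth: "transpose T ! c ! i = T ! i ! c" if "i < length T" "c < length (T ! i)" for i c
    using that cell[of c i] srt by (intro nth_nth_transpose_sorted) (auto simp: nth_transpose)
  show lin': "lines_in A (transpose T)"
    unfolding lines_in_def
  proof
    fix l assume "l \<in> set (transpose T)"
    then obtain c where c: "c < length (transpose T)" "l = transpose T ! c" by (auto simp: in_set_conv_nth)
    have "l \<noteq> []" using c by (auto simp: nth_transpose less_length_transpose_iff filter_empty_conv)
    moreover have "set l \<subseteq> A"
    proof
      fix x assume "x \<in> set l"
      then obtain i where i: "i < length l" "x = l ! i" by (auto simp: in_set_conv_nth)
      then have "i < length T" "c < length (T ! i)" using c cell by blast+
      moreover then have "x = T ! i ! c" using nth i(2) c(2) by simp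
      ultimately have "x \<in> set (line T i)" by (simp add: line_def)
      then show "x \<in> A" using set_line_subset[OF lin] by blast
    qed
    moreover have "sorted l"
      unfolding sorted_iff_nth_Suc
    proof (intro allI impI)
      fix i assume "Suc i < length l"
      then have i: "Suc i < length T" "c < length (T ! Suc i)" "i < length T" "c < length (T ! i)"
        using c cell[of c i] cell[of c "Suc i"] by auto
      have "c < count_le (T ! Suc i ! c) (line T (Suc i))"
        using i by (simp add: less_count_le_line_iff[OF sorted])
      also note le
      finally show "l ! i \<le> l ! Suc i"
        using i nth c(2) by (simp add: less_count_le_line_iff[OF sorted])
    qed
    ultimately show "l \<noteq> [] \<and> sorted l \<and> set l \<subseteq> A" by blast
  qed
  show "c < count_le k (line T i) \<longleftrightarrow> i < count_le k (line (transpose T) c)"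
    unfolding less_count_le_line_iff[OF sorted] less_count_le_line_iff[OF lines_in_sorted[OF lin']]
    using cell[of c i] nth[of i c] by auto
qed

section \<open>Column insertion\<close>

lemma h_insertion_eq_col_insertion:
  assumes T: "semistandard N T" and m: "m \<in> {1..N}"
  shows "h_insertion N (\<lambda>k. k) m T = col_insertion m T"
proof -
  define C where "C = transpose T"
  define C' where "C' = bump_insert (\<le>) m C"
  define T' where "T' = transpose C'"
  let ?L = "\<lambda>k i. count_le k (line T i)" and ?H = "\<lambda>k c. count_le k (line C c)"
  note lin = semistandard_lines_in[OF T] and L = semistandard_count_le[OF T]
  have mono: "count_le k l \<le> count_le (Suc k) l" for k l by (rule count_le_mono) simp
  have L0: "?L k (Suc i) \<le> ?L k i" for k i using mono[of k "line T (Suc i)"] L[of k i] by linarith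
  \<comment> \<open>\<open>?L k\<close> and \<open>?H k\<close> are conjugate partitions;
    \<open>tr(2)\<close> carries facts on rows over to columns.\<close>
  note tr = transpose_lines[OF lin _ L0, folded C_def, simplified]
  have linC: "lines_in {1..N} C" using tr(1) by simp
  have H: "?H k (Suc c) \<le> ?H k c" for k c
  proof (rule ccontr)
    assume "\<not> ?thesis"
    then have "?H k c < ?H k (Suc c)" by simp
    then have "Suc c < ?L k (?H k c)" using tr(2) by blast
    then have "c < ?L k (?H k c)" by simp
    then show False using tr(2) by blast
  qed
  \<comment> \<open>Columns increase strictly, so each contains \<open>Suc k\<close> at most
    once.\<close>
  have H_Suc: "?H (Suc k) c \<le> Suc (?H k c)" for k c
  proof (rule ccontr)
    assume "\<not> ?thesis"
    then have "Suc (?H k c) < ?H (Suc k) c" by simp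
    then have "c < ?L (Suc k) (Suc (?H k c))" using tr(2) by blast
    then have "c < ?L k (?H k c)" using L[of k "?H k c"] by linarith
    then show False using tr(2) by blast
  qed
  have H_anti: "?H k d \<le> ?H k c" if "c \<le> d" for k c d
    using that lift_Suc_antimono_le[of "?H k"] H by blast
  obtain f where f: "m \<notin> set (line C (f m))" "\<And>c. c < f m \<Longrightarrow> m \<in> set (line C c)"
    "\<And>k. m \<le> k \<Longrightarrow> f k \<le> f (Suc k)" "\<And>k. m \<le> k \<Longrightarrow> Suc k \<notin> set (line C (f (Suc k)))"
    "\<And>k c. m \<le> k \<Longrightarrow> f k \<le> c \<Longrightarrow> c < f (Suc k) \<Longrightarrow> Suc k \<in> set (line C c)"
    "\<And>k j. count_le k (line C' j) = ?H k j + (if m \<le> k \<and> j = f k then 1 else 0)"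
    unfolding C'_def using bump_insert_le_path[OF lines_in_sorted[OF linC]] by blast
  \<comment> \<open>Column \<open>f k\<close> has room for a box: each column passed over contains
    the letter searched for at that level, the column reached does not.\<close>
  have corner: "?H k (f k) < ?H k c" if "m \<le> k" "c < f k" for k c
    using that
  proof (induction k arbitrary: c rule: dec_induct)
    case base
    obtain m' where m': "m = Suc m'" using m by (cases m) auto
    show ?case
      using count_le_Suc_less[of m' "line C c"] f(2)[OF base] H_anti[of c "f m" m'] base
        count_le_Suc_eq[of m' "line C (f m)"] f(1) by (simp add: m')
  next
    case (step k)
    have e: "?H (Suc k) (f (Suc k)) = ?H k (f (Suc k))"
      using f(4)[OF step.hyps(1)] by (rule count_le_Suc_eq)
    show ?case
    proof (cases "c < f k")
      case True
      then show ?thesis using step.IH[OF True] H_anti[OF f(3)[OF step.hyps(1)], of k]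
          mono[of k "line C c"] e by linarith
    next
      case False
      then have "?H k c < ?H (Suc k) c" using f(5)[OF step.hyps(1)] step.prems
        by (intro count_le_Suc_less) simp
      then show ?thesis using H_anti[of c "f (Suc k)" k] e step.prems by simp
    qed
  qed
  have linC': "lines_in {1..N} C'"
    unfolding C'_def by (rule lines_in_bump_insert[OF linC m]) auto
  have H': "count_le k (line C' (Suc c)) \<le> count_le k (line C' c)" for k c
    using H[of k c] corner[of k c] by (auto simp: f(6))
  note tr' = transpose_lines[OF linC' _ H', folded T'_def, simplified]
  \<comment> \<open>Seen from the rows, the box added to column \<open>f k\<close> lies in row
    \<open>?H k (f k)\<close>.\<close>
  have cnt: "count_le k (line T' i) = ?L k i + (if m \<le> k \<and> i = ?H k (f k) then 1 else 0)" for k i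
  proof -
    have *: "c < count_le k (line T' i) \<longleftrightarrow> c < ?L k i \<or> (m \<le> k \<and> c = f k \<and> i = ?H k (f k))" for c
      unfolding tr'(2)[symmetric] f(6) tr(2) by auto
    show ?thesis
    proof (cases "m \<le> k \<and> i = ?H k (f k)")
      case True
      have "{..<count_le k (line T' i)} = insert (f k) {..<?L k i}" using * True by auto
      moreover have "f k \<notin> {..<?L k i}" using tr(2) True by auto
      ultimately have "card {..<count_le k (line T' i)} = Suc (card {..<?L k i})" by simp
      then show ?thesis using True by simp
    next
      case False
      then have "c < count_le k (line T' i) \<longleftrightarrow> c < ?L k i" for c using * by blast
      then have "count_le k (line T' i) = ?L k i" by (meson less_irrefl linorder_neqE_nat)
      then show ?thesis unfolding if_not_P[OF False] by simp
    qed
  qed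
  have T': "semistandard N T'"
  proof (rule semistandardI)
    show "lines_in {1..N} T'" using tr'(1) by simp
    fix k i
    show "count_le (Suc k) (line T' (Suc i)) \<le> count_le k (line T' i)"
    proof (rule ccontr)
      \<comment> \<open>A violation makes column \<open>c\<close> grow by at least two between the
        levels. Only the box added at level \<open>Suc k\<close> could cause this, but column
        \<open>f (Suc k)\<close> of \<open>C\<close> does not contain \<open>Suc k\<close>.\<close>
      define c where "c = count_le k (line T' i)"
      assume "\<not> ?thesis"
      then have "c < count_le (Suc k) (line T' (Suc i))" by (simp add: c_def)
      then have "Suc i < count_le (Suc k) (line C' c)" using tr'(2) by blast
      moreover have "\<not> i < count_le k (line C' c)" unfolding tr'(2) c_def by simp
      ultimately have "Suc (count_le k (line C' c)) < count_le (Suc k) (line C' c)" by simp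
      then have *: "Suc (?H k c + (if m \<le> k \<and> c = f k then 1 else 0)) <
        ?H (Suc k) c + (if m \<le> Suc k \<and> c = f (Suc k) then 1 else 0)" unfolding f(6) .
      then have c: "m \<le> Suc k" "c = f (Suc k)" using H_Suc[of k c] by (auto split: if_splits)
      have "Suc k \<notin> set (line C c)" using f(1,4) c by (cases "m = Suc k") auto
      then show False using * c count_le_Suc_eq by fastforce
    qed
  qed
  \<comment> \<open>The row that grows holds a letter \<open>\<le> k\<close> afterwards, which
    bounds its index.\<close>
  have below: "?H k (f k) < k" if "m \<le> k" for k
    using semistandard_count_le_pos[OF T', of k "?H k (f k)"] that by (simp add: cnt)
  \<comment> \<open>Particle \<open>i\<close> is asked to move and the column search starts at
    \<open>c\<close>. By \<open>long\<close>, the nonempty rows above particle \<open>i\<close>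
    extend past column \<open>c\<close>, so their ends lie in the range searched.\<close>
  have donate: "donate (array_of N T) (Suc k) i = Suc (?H (Suc k) (f (Suc k)))"
    if k: "m \<le> Suc k" "Suc k \<le> N" and i: "?H (Suc k) (f (Suc k)) < i"
      and c: "c \<le> f (Suc k)" "\<And>d. c \<le> d \<Longrightarrow> d < f (Suc k) \<Longrightarrow> Suc k \<in> set (line C d)"
      and long: "\<And>r. Suc r < i \<Longrightarrow> c < ?L k r \<or> ?L k r = 0" for k i c
  proof -
    let ?c' = "f (Suc k)"
    let ?i' = "?H (Suc k) ?c'"
    have A: "array_of N T k (Suc i) = ?L k i" "array_of N T (Suc k) (Suc i) = ?L (Suc k) i" for i
      using array_of_eq_count_le[OF T] k by auto
    have "Suc k \<notin> set (line C ?c')" using f(1,4) k(1) by (cases "m = Suc k") auto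
    then have e: "?i' = ?H k ?c'" by (rule count_le_Suc_eq)
    show ?thesis
    proof (rule donate_eqI)
      show "\<not> blocked (array_of N T) (Suc k) (Suc ?i')"
      proof (cases ?i')
        \<comment> \<open>Row \<open>i0\<close> reaches column \<open>?c'\<close> at level
          \<open>k\<close>, whereas row \<open>Suc i0\<close> stops before it at level
          \<open>Suc k\<close>.\<close>
        case (Suc i0)
        then have "?c' < ?L k i0" using tr(2) e by simp
        moreover have "\<not> ?c' < ?L (Suc k) (Suc i0)" using tr(2) Suc by simp
        ultimately show ?thesis using Suc A by (auto simp: blocked_def)
      qed (simp add: blocked_def)
      fix r assume r: "Suc ?i' < r" "r \<le> i"
      then obtain s where s: "r = Suc (Suc s)" by (cases r; cases "r - 1") auto
      have "?L (Suc k) (Suc s) = ?L k s"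
      proof (rule antisym[OF L], cases "?L k s")
        \<comment> \<open>Column \<open>d\<close> is the end of row \<open>s\<close> at level
          \<open>k\<close>. It lies between \<open>c\<close> and \<open>?c'\<close>, so it contains
          \<open>Suc k\<close>, and row \<open>Suc s\<close> catches up with row
          \<open>s\<close>.\<close>
        case (Suc d)
        have "d < ?L k s" using Suc by simp
        then have s1: "s < ?H k d" using tr(2) by blast
        have "\<not> ?c' < ?L k s" unfolding tr(2) using r s e by simp
        then have "d < ?c'" using Suc by simp
        moreover have "c \<le> d" using long[of s] r s Suc by simp
        ultimately have "Suc k \<in> set (line C d)" using c(2) by blast
        then have "Suc s < ?H (Suc k) d" using s1 count_le_Suc_less[of k "line C d"] by linarith
        then have "d < ?L (Suc k) (Suc s)" using tr(2) by blast
        then show "?L k s \<le> ?L (Suc k) (Suc s)" using Suc by simp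
      qed simp
      then show "blocked (array_of N T) (Suc k) r" using A s by (simp add: blocked_def)
    qed (use i in auto)
  qed
  show ?thesis unfolding col_insertion_def C_def[symmetric] C'_def[symmetric] T'_def[symmetric]
  proof (rule h_insertion_eqI[OF T T' cnt])
    fix d
    show "m + d \<le> N \<Longrightarrow> moved (array_of N T) (\<lambda>k. k) m d = Suc (?H (m + d) (f (m + d)))"
    proof (induction d)
      case 0
      obtain k where k: "m = Suc k" using m by (cases m) auto
      \<comment> \<open>With \<open>h m = m\<close> the last particle is asked, and the search runs
        from column 0.\<close>
      have "donate (array_of N T) (Suc k) m = Suc (?H (Suc k) (f (Suc k)))"
        by (rule donate[where c = 0]) (use below[of m] f(2) 0 k in auto)
      then show ?case by (simp add: k)
    next
      case (Suc d)
      let ?k = "m + d"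
      let ?i = "Suc (?H ?k (f ?k))"
      have IH: "moved (array_of N T) (\<lambda>k. k) m d = ?i" using Suc by simp
      \<comment> \<open>This is \<open>j < h k\<close> at the new level, so the same index is always
        asked to move.\<close>
      have "?i < Suc ?k" using below[of ?k] by simp
      moreover have "donate (array_of N T) (Suc ?k) ?i = Suc (?H (Suc ?k) (f (Suc ?k)))"
      proof (rule donate[where c = "f ?k"])
        show "?H (Suc ?k) (f (Suc ?k)) < ?i"
          using count_le_Suc_eq[OF f(4)[of ?k]] H_anti[OF f(3)[of ?k], of ?k] by simp
        show "f ?k < ?L ?k r \<or> ?L ?k r = 0" if "Suc r < ?i" for r
          unfolding tr(2) using that by simp
      qed (use f(3,5) Suc.prems in auto)
      ultimately show ?case using IH by (simp add: Let_def)
    qed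
  qed
qed

theorem proposition7p3:
  fixes N m :: nat and P :: "nat list list"
  assumes "1 \<le> N" and "semistandard N P" and "m \<in> {1..N}"
  shows "h_vector N (\<lambda>k. 1) \<and> h_insertion N (\<lambda>k. 1) m P = row_insertion m P \<and>
         h_vector N (\<lambda>k. k) \<and> h_insertion N (\<lambda>k. k) m P = col_insertion m P"
  using h_insertion_eq_row_insertion[OF assms(2,3)] h_insertion_eq_col_insertion[OF assms(2,3)]
  by (simp add: h_vector_def)

end
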